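(* Let $n$ be a positive integer. Then every $n$-distributive lattice $L$ can be embedded (as a sublattice), within its variety, into an algebraic and strongly spatial lattice $\overline{L}$ such that if $L$ has a least element (a largest element, both a least and a largest element, respectively), then so does $\overline{L}$.
   Context: A lattice is $n$-distributive if it satisfies the identity $x\wedge\bigvee_{0\le i\le n}y_i=\bigvee_{0\le i\le n}\bigl(x\wedge\bigvee_{0\le j\le n,\,j\ne i}y_j\bigr)$. "$L$ embeds within its variety into $\overline{L}$" means that there is a lattice embedding $L\hookrightarrow\overline{L}$ and $\overline{L}$ belongs to the lattice variety generated by $L$ (that is, $\overline{L}$ satisfies every lattice identity satisfied by $L$). An element $a$ of a lattice $M$ is compact if for every nonempty directed subset $D$ of $M$ with a join, $a\le\bigvee D$ implies $a\le d$ for some $d\in D$. A subset $\Sigma$ of $M$ is join-dense if every element of $M$ is a (possibly infinite or empty) join of elements of $\Sigma$. $M$ is algebraic if it is complete and its set of compact elements is join-dense. A point (completely join-irreducible element) of $M$ is an element $p$ such that the set $\{x\in M\mid x<p\}$ has a largest element; $\mathrm{J}_{\mathrm c}(M)$ denotes the set of points of $M$. A subset $X$ refines a subset $Y$ if every element of $X$ is below some element of $Y$. A finite subset $E\subseteq M$ is a join-cover of $p$ if $p\le\bigvee E$ ($\bigvee\varnothing$ is the least element if it exists; otherwise $\varnothing$ covers nothing); it is a minimal join-cover of $p$ if moreover, for every join-cover $X$ of $p$ refining $E$, one has $E\subseteq X$. $M$ is strongly spatial if $\mathrm{J}_{\mathrm c}(M)$ is join-dense in $M$ and for every point $p$ of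 $M$ and every join-cover $X$ of $p$, there is a minimal join-cover $I$ of $p$ with $I\subseteq\mathrm{J}_{\mathrm c}(M)$ and $I$ refining $X$. *)

theory Defs
  imports "HOL-Algebra.Complete_Lattice"
begin

text \<open>Both indexed joins below are over nonempty sets when \<open>n > 0\<close>; for \<open>n = 0\<close> the inner one is
  empty, so the definition is meaningful only for positive \<open>n\<close>.\<close>

definition n_distributive :: "nat \<Rightarrow> 'a gorder \<Rightarrow> bool" where
  "n_distributive n L \<longleftrightarrow>
    (\<forall>x \<in> carrier L. \<forall>y \<in> {..n} \<rightarrow> carrier L.
      x \<sqinter>\<^bsub>L\<^esub> (\<Squnion>\<^bsub>L\<^esub> (y ` {..n})) =
      \<Squnion>\<^bsub>L\<^esub> ((\<lambda>i. x \<sqinter>\<^bsub>L\<^esub> (\<Squnion>\<^bsub>L\<^esub> (y ` ({..n} - {i})))) ` {..n}))"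

datatype lat_term = Var nat | Join lat_term lat_term | Meet lat_term lat_term

primrec lat_eval :: "'a gorder \<Rightarrow> (nat \<Rightarrow> 'a) \<Rightarrow> lat_term \<Rightarrow> 'a" where
  "lat_eval L v (Var i) = v i"
| "lat_eval L v (Join s t) = lat_eval L v s \<squnion>\<^bsub>L\<^esub> lat_eval L v t"
| "lat_eval L v (Meet s t) = lat_eval L v s \<sqinter>\<^bsub>L\<^esub> lat_eval L v t"

definition satisfies_identity :: "'a gorder \<Rightarrow> lat_term \<Rightarrow> lat_term \<Rightarrow> bool" where
  "satisfies_identity L s t \<longleftrightarrow>
    (\<forall>v \<in> UNIV \<rightarrow> carrier L. lat_eval L v s = lat_eval L v t)"

definition in_variety_of :: "'b gorder \<Rightarrow> 'a gorder \<Rightarrow> bool" where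
  "in_variety_of M L \<longleftrightarrow> lattice M \<and>
    (\<forall>s t. satisfies_identity L s t \<longrightarrow> satisfies_identity M s t)"

text \<open>\<^const>\<open>join_pres\<close> and \<^const>\<open>meet_pres\<close> include that both structures are lattices.\<close>

definition lattice_embedding :: "'a gorder \<Rightarrow> 'b gorder \<Rightarrow> ('a \<Rightarrow> 'b) \<Rightarrow> bool" where
  "lattice_embedding L M f \<longleftrightarrow>
    f \<in> carrier L \<rightarrow> carrier M \<and> inj_on f (carrier L) \<and> join_pres L M f \<and> meet_pres L M f"

definition directed :: "'a gorder \<Rightarrow> 'a set \<Rightarrow> bool" where
  "directed M D \<longleftrightarrow> (\<forall>x \<in> D. \<forall>y \<in> D. \<exists>z \<in> D. x \<sqsubseteq>\<^bsub>M\<^esub> z \<and> y \<sqsubseteq>\<^bsub>M\<^esub> z)"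

definition compact_elements :: "'a gorder \<Rightarrow> 'a set" where
  "compact_elements M = {a \<in> carrier M.
    \<forall>D s. D \<subseteq> carrier M \<and> D \<noteq> {} \<and> directed M D \<and> is_lub M s D \<and> a \<sqsubseteq>\<^bsub>M\<^esub> s \<longrightarrow>
      (\<exists>d \<in> D. a \<sqsubseteq>\<^bsub>M\<^esub> d)}"

definition join_dense :: "'a gorder \<Rightarrow> 'a set \<Rightarrow> bool" where
  "join_dense M S \<longleftrightarrow>
    S \<subseteq> carrier M \<and> (\<forall>x \<in> carrier M. \<exists>A \<subseteq> S. is_lub M x A)"

definition algebraic_lattice :: "'a gorder \<Rightarrow> bool" where
  "algebraic_lattice M \<longleftrightarrow> complete_lattice M \<and> join_dense M (compact_elements M)"

definition points :: "'a gorder \<Rightarrow> 'a set" where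
  "points M = {p \<in> carrier M. \<exists>q. greatest M q {x \<in> carrier M. x \<sqsubset>\<^bsub>M\<^esub> p}}"

definition refines :: "'a gorder \<Rightarrow> 'a set \<Rightarrow> 'a set \<Rightarrow> bool" where
  "refines M X Y \<longleftrightarrow> (\<forall>x \<in> X. \<exists>y \<in> Y. x \<sqsubseteq>\<^bsub>M\<^esub> y)"

text \<open>A least upper bound of the empty set is a least element of the carrier, so the empty set is a
  join-cover only if a least element exists.\<close>

definition join_cover :: "'a gorder \<Rightarrow> 'a \<Rightarrow> 'a set \<Rightarrow> bool" where
  "join_cover M p E \<longleftrightarrow>
    finite E \<and> E \<subseteq> carrier M \<and> (\<exists>s. is_lub M s E \<and> p \<sqsubseteq>\<^bsub>M\<^esub> s)"

definition minimal_join_cover :: "'a gorder \<Rightarrow> 'a \<Rightarrow> 'a set \<Rightarrow> bool" where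
  "minimal_join_cover M p E \<longleftrightarrow> join_cover M p E \<and>
    (\<forall>X. join_cover M p X \<and> refines M X E \<longrightarrow> E \<subseteq> X)"

definition strongly_spatial :: "'a gorder \<Rightarrow> bool" where
  "strongly_spatial M \<longleftrightarrow> lattice M \<and> join_dense M (points M) \<and>
    (\<forall>p \<in> points M. \<forall>X. join_cover M p X \<longrightarrow>
      (\<exists>I. minimal_join_cover M p I \<and> I \<subseteq> points M \<and> refines M I X))"

definition has_least :: "'a gorder \<Rightarrow> bool" where
  "has_least M \<longleftrightarrow> (\<exists>z. least M z (carrier M))"

definition has_greatest :: "'a gorder \<Rightarrow> bool" where
  "has_greatest M \<longleftrightarrow> (\<exists>u. greatest M u (carrier M))"

end

theory Submission
  imports Defs
begin

text \<open>The points of the lattice to be built are the join-irreducible elements of the lattice of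
  nonempty filters of \<open>L\<close>, ordered by reverse inclusion. By \<open>n\<close>-distributivity an irredundant cover
  of such an irreducible filter \<open>p\<close> has at most \<open>n\<close> members. Among the irredundant covers refining a
  given one, take one with the largest number of members and enlarge its members as filters as
  long as they still cover \<open>p\<close> (Zorn). If a member were a proper join of two elements, replacing it
  by these two would produce a longer irredundant cover; hence all members are irreducible, and
  the cover is minimal. Consequently, mapping an ideal of the filter lattice to the set of
  irreducible elements in it is a lattice homomorphism onto the lattice of sets of irreducible
  elements closed under covers, which is therefore algebraic, strongly spatial, and in the variety
  of \<open>L\<close>. The irreducible filters need not be completely irreducible among the filters, but they
  generate the completely irreducible closed sets.\<close>

section \<open>Filters and irreducible filters\<close>

context lattice
begin

lemma finite_sup_upper:
  "finite A \<Longrightarrow> A \<subseteq> carrier L \<Longrightarrow> x \<in> A \<Longrightarrow> x \<sqsubseteq> \<Squnion>A"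
  by (rule least_Upper_above[OF finite_sup_least]) auto

lemma finite_sup_le:
  assumes "finite A" "A \<subseteq> carrier L" "A \<noteq> {}" "c \<in> carrier L" "\<And>x. x \<in> A \<Longrightarrow> x \<sqsubseteq> c"
  shows "\<Squnion>A \<sqsubseteq> c"
  using finite_sup_least[OF assms(1-3)] assms(4,5) unfolding least_def Upper_def by blast

lemma finite_inf_lower:
  "finite A \<Longrightarrow> A \<subseteq> carrier L \<Longrightarrow> x \<in> A \<Longrightarrow> \<Sqinter>A \<sqsubseteq> x"
  by (rule greatest_Lower_below[OF finite_inf_greatest]) auto

lemma finite_inf_ge:
  assumes "finite A" "A \<subseteq> carrier L" "A \<noteq> {}" "c \<in> carrier L" "\<And>x. x \<in> A \<Longrightarrow> c \<sqsubseteq> x"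
  shows "c \<sqsubseteq> \<Sqinter>A"
  using finite_inf_greatest[OF assms(1-3)] assms(4,5) unfolding greatest_def Lower_def by blast

text \<open>Under reverse inclusion the join of two filters is their intersection, their meet is
  \<open>filter_join\<close>, and \<open>carrier L\<close> is the least filter.\<close>

definition filters :: "'a set set" where
  "filters = {F. F \<subseteq> carrier L \<and> F \<noteq> {} \<and> (\<forall>a\<in>F. \<forall>b\<in>F. a \<sqinter> b \<in> F) \<and>
    (\<forall>a\<in>F. \<forall>b\<in>carrier L. a \<sqsubseteq> b \<longrightarrow> b \<in> F)}"

lemma filters_subset: "F \<in> filters \<Longrightarrow> F \<subseteq> carrier L"
  and filters_ne: "F \<in> filters \<Longrightarrow> F \<noteq> {}"
  and filters_meet: "F \<in> filters \<Longrightarrow> a \<in> F \<Longrightarrow> b \<in> F \<Longrightarrow> a \<sqinter> b \<in> F"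
  and filters_up: "F \<in> filters \<Longrightarrow> a \<in> F \<Longrightarrow> b \<in> carrier L \<Longrightarrow> a \<sqsubseteq> b \<Longrightarrow> b \<in> F"
  by (auto simp: filters_def)

lemma filters_mem: "F \<in> filters \<Longrightarrow> a \<in> F \<Longrightarrow> a \<in> carrier L"
  using filters_subset by blast

lemma filtersI:
  assumes "F \<subseteq> carrier L" "x \<in> F" "\<And>a b. a \<in> F \<Longrightarrow> b \<in> F \<Longrightarrow> a \<sqinter> b \<in> F"
    "\<And>a b. a \<in> F \<Longrightarrow> b \<in> carrier L \<Longrightarrow> a \<sqsubseteq> b \<Longrightarrow> b \<in> F"
  shows "F \<in> filters"
  using assms unfolding filters_def by blast

text \<open>The filter \<open>F\<close> is there to witness that the carrier is nonempty.\<close>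

lemma carrier_filter: "F \<in> filters \<Longrightarrow> carrier L \<in> filters"
  unfolding filters_def by auto

lemma filters_Int:
  assumes "F \<in> filters" "G \<in> filters" shows "F \<inter> G \<in> filters"
proof -
  obtain a b where ab: "a \<in> F" "b \<in> G" using assms filters_ne by blast
  note c = filters_mem[OF assms(1) ab(1)] filters_mem[OF assms(2) ab(2)]
  show ?thesis
  proof (rule filtersI)
    show "a \<squnion> b \<in> F \<inter> G"
      using filters_up[OF assms(1) ab(1)] filters_up[OF assms(2) ab(2)] c
      by (simp add: join_left join_right)
  qed (use assms filters_mem filters_meet filters_up in blast)+
qed

lemma filters_Inter:
  assumes "finite E" "E \<noteq> {}" "E \<subseteq> filters" shows "\<Inter>E \<in> filters"
  using assms by (induction E rule: finite_ne_induct) (auto intro: filters_Int)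

lemma filters_finite_inf:
  assumes "F \<in> filters" "finite A" "A \<noteq> {}" "A \<subseteq> F" shows "\<Sqinter>A \<in> F"
  using assms(2-4)
proof (induction A rule: finite_ne_induct)
  case (singleton x)
  then have x: "x \<in> carrier L" "x \<in> F" using assms(1) filters_mem by auto
  then show ?case
    using filters_up[OF assms(1), of x "\<Sqinter>{x}"] finite_inf_ge[of "{x}" x] finite_inf_closed[of "{x}"]
    by auto
next
  case (insert x A)
  have A: "A \<subseteq> carrier L" "x \<in> carrier L" using insert assms(1) filters_mem by auto
  have "x \<sqinter> \<Sqinter>A \<in> F" using insert assms(1) filters_meet by auto
  moreover have "x \<sqinter> \<Sqinter>A \<sqsubseteq> \<Sqinter>(insert x A)"
  proof (rule finite_inf_ge)
    have c: "\<Sqinter>A \<in> carrier L" using A insert by simp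
    then show "x \<sqinter> \<Sqinter>A \<in> carrier L" using A by simp
    fix y assume "y \<in> insert x A"
    then show "x \<sqinter> \<Sqinter>A \<sqsubseteq> y"
    proof
      assume "y \<in> A"
      then have "\<Sqinter>A \<sqsubseteq> y" "y \<in> carrier L" using insert A finite_inf_lower by auto
      then show ?thesis using meet_right[OF A(2) c] c A le_trans by (meson meet_closed)
    qed (use meet_left[OF A(2) c] in simp)
  qed (use insert A in auto)
  ultimately show ?case
    using filters_up[OF assms(1)] insert A by (metis finite_inf_closed finite.insertI insert_not_empty insert_subset)
qed

lemma principal_filter: "a \<in> carrier L \<Longrightarrow> {b \<in> carrier L. a \<sqsubseteq> b} \<in> filters"
  by (rule filtersI[of _ a]) (auto intro: meet_le le_trans)

text \<open>The filter generated by the union. It is a join for inclusion, hence the meet in the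
  filter lattice as ordered here.\<close>

definition filter_join :: "'a set \<Rightarrow> 'a set \<Rightarrow> 'a set" where
  "filter_join F G = {c \<in> carrier L. \<exists>a\<in>F. \<exists>b\<in>G. a \<sqinter> b \<sqsubseteq> c}"

lemma meet_mono:
  assumes "a \<sqsubseteq> c" "b \<sqsubseteq> d" "a \<in> carrier L" "b \<in> carrier L" "c \<in> carrier L" "d \<in> carrier L"
  shows "a \<sqinter> b \<sqsubseteq> c \<sqinter> d"
proof (rule meet_le)
  show "a \<sqinter> b \<sqsubseteq> c" using le_trans[OF meet_left assms(1)] assms by simp
  show "a \<sqinter> b \<sqsubseteq> d" using le_trans[OF meet_right assms(2)] assms by simp
qed (use assms in auto)

lemma join_mono:
  assumes "a \<sqsubseteq> c" "b \<sqsubseteq> d" "a \<in> carrier L" "b \<in> carrier L" "c \<in> carrier L" "d \<in> carrier L"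
  shows "a \<squnion> b \<sqsubseteq> c \<squnion> d"
proof (rule join_le)
  show "a \<sqsubseteq> c \<squnion> d" using le_trans[OF assms(1) join_left] assms by simp
  show "b \<sqsubseteq> c \<squnion> d" using le_trans[OF assms(2) join_right] assms by simp
qed (use assms in auto)

text \<open>Nonemptiness of the other filter is essential: \<open>x \<in> F\<close> lies above
  \<open>x \<sqinter> b\<close> for any \<open>b \<in> G\<close>.\<close>

lemma filter_join_upper:
  assumes "F \<in> filters" "G \<in> filters"
  shows "F \<subseteq> filter_join F G" "G \<subseteq> filter_join F G"
proof -
  obtain a b where ab: "a \<in> F" "b \<in> G" using assms filters_ne by blast
  note c = filters_mem[OF assms(1)] filters_mem[OF assms(2)]
  show "F \<subseteq> filter_join F G"
  proof
    fix x assume "x \<in> F"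
    then show "x \<in> filter_join F G"
      using ab c meet_left[of x b] unfolding filter_join_def by blast
  qed
  show "G \<subseteq> filter_join F G"
  proof
    fix x assume "x \<in> G"
    then show "x \<in> filter_join F G"
      using ab c meet_right[of a x] unfolding filter_join_def by blast
  qed
qed

lemma filter_join_least:
  assumes "H \<in> filters" "F \<subseteq> H" "G \<subseteq> H" shows "filter_join F G \<subseteq> H"
  using assms filters_meet filters_up unfolding filter_join_def by blast

lemma filter_join_filters:
  assumes "F \<in> filters" "G \<in> filters" shows "filter_join F G \<in> filters"
proof -
  obtain x where "x \<in> F" using assms filters_ne by blast
  then show ?thesis
  proof (intro filtersI[of _ x])
    show "x \<in> filter_join F G" using \<open>x \<in> F\<close> filter_join_upper[OF assms] by blast
  next
    fix c d assume "c \<in> filter_join F G" "d \<in> filter_join F G"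
    then obtain a b a' b' where h: "c \<in> carrier L" "d \<in> carrier L" "a \<in> F" "b \<in> G" "a \<sqinter> b \<sqsubseteq> c"
      "a' \<in> F" "b' \<in> G" "a' \<sqinter> b' \<sqsubseteq> d" unfolding filter_join_def by blast
    then have k: "a \<in> carrier L" "a' \<in> carrier L" "b \<in> carrier L" "b' \<in> carrier L"
      using assms filters_mem by auto
    have "(a \<sqinter> a') \<sqinter> (b \<sqinter> b') \<sqsubseteq> a \<sqinter> b" "(a \<sqinter> a') \<sqinter> (b \<sqinter> b') \<sqsubseteq> a' \<sqinter> b'"
      using k by (auto intro!: meet_mono meet_left meet_right)
    then have "(a \<sqinter> a') \<sqinter> (b \<sqinter> b') \<sqsubseteq> c \<sqinter> d"
      using h k by (intro meet_le) (auto intro: le_trans)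
    then show "c \<sqinter> d \<in> filter_join F G"
      using filters_meet[OF assms(1) h(3,6)] filters_meet[OF assms(2) h(4,7)] h(1,2)
      unfolding filter_join_def by auto
  next
    fix c d assume c: "c \<in> filter_join F G" and d: "d \<in> carrier L" "c \<sqsubseteq> d"
    then obtain a b where h: "c \<in> carrier L" "a \<in> F" "b \<in> G" "a \<sqinter> b \<sqsubseteq> c"
      unfolding filter_join_def by blast
    then have "a \<sqinter> b \<sqsubseteq> d"
      using le_trans[OF h(4) d(2)] d filters_mem[OF assms(1)] filters_mem[OF assms(2)] by simp
    then show "d \<in> filter_join F G" using h d unfolding filter_join_def by blast
  qed (auto simp: filter_join_def)
qed

text \<open>Zorn's lemma, as \<open>G \<inter> D \<subseteq> S\<close> survives unions of chains.
  With \<open>D = {a}\<close> and \<open>S = {}\<close> it separates a point from a filter; with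
  \<open>D\<close> the intersection of the other members of a cover of \<open>S = p\<close> it
  enlarges one member.\<close>

lemma maximal_filter_exists:
  assumes "F \<in> filters" "F \<inter> D \<subseteq> S"
  obtains G where "G \<in> filters" "F \<subseteq> G" "G \<inter> D \<subseteq> S"
    "\<And>H. H \<in> filters \<Longrightarrow> G \<subset> H \<Longrightarrow> \<not> H \<inter> D \<subseteq> S"
proof -
  let ?A = "{G \<in> filters. F \<subseteq> G \<and> G \<inter> D \<subseteq> S}"
  have "\<exists>M\<in>?A. \<forall>X\<in>?A. M \<subseteq> X \<longrightarrow> X = M"
  proof (rule subset_Zorn_nonempty)
    show "?A \<noteq> {}" using assms by blast
    fix C assume C: "C \<noteq> {}" "subset.chain ?A C"
    then obtain G where G: "G \<in> C" by blast
    have sub: "H \<in> filters" "F \<subseteq> H" "H \<inter> D \<subseteq> S" if "H \<in> C" for H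
      using C that unfolding subset.chain_def by auto
    then obtain x where "x \<in> G" using G filters_ne by blast
    have "\<Union>C \<in> filters"
    proof (rule filtersI[of _ x])
      show "x \<in> \<Union>C" using \<open>x \<in> G\<close> G by blast
      show "\<Union>C \<subseteq> carrier L" using sub filters_subset by blast
      fix a b assume "a \<in> \<Union>C" "b \<in> \<Union>C"
      then obtain H K where HK: "a \<in> H" "H \<in> C" "b \<in> K" "K \<in> C" by blast
      then have "H \<subseteq> K \<or> K \<subseteq> H" using subset.chain_total[OF C(2)] by blast
      then show "a \<sqinter> b \<in> \<Union>C"
        using HK filters_meet[OF sub(1)[OF HK(2)], of a b] filters_meet[OF sub(1)[OF HK(4)], of a b]
        by blast
    next
      fix a b assume "a \<in> \<Union>C" "b \<in> carrier L" "a \<sqsubseteq> b"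
      then show "b \<in> \<Union>C" using filters_up[OF sub(1)] by blast
    qed
    then show "\<Union>C \<in> ?A" using sub G by blast
  qed
  then obtain G where G: "G \<in> ?A" and mx: "\<forall>H\<in>?A. G \<subseteq> H \<longrightarrow> H = G" by (rule bexE)
  show thesis
  proof (rule that)
    show "\<not> H \<inter> D \<subseteq> S" if "H \<in> filters" "G \<subset> H" for H
      using bspec[OF mx, of H] G that by auto
  qed (use G in auto)
qed

text \<open>Join-irreducibility for reverse inclusion. Excluding \<open>carrier L\<close> excludes
  the least filter, which is the join of the empty family.\<close>

definition irreducible_filters :: "'a set set" where
  "irreducible_filters = {p \<in> filters. p \<noteq> carrier L \<and>
    (\<forall>F\<in>filters. \<forall>G\<in>filters. p = F \<inter> G \<longrightarrow> p = F \<or> p = G)}"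

lemma irreducible_filter: "p \<in> irreducible_filters \<Longrightarrow> p \<in> filters"
  by (simp add: irreducible_filters_def)

text \<open>Since \<open>\<Inter>{}\<close> is \<open>UNIV\<close>, this expresses that the empty
  family covers no irreducible filter.\<close>

lemma irreducible_not_UNIV: "p \<in> irreducible_filters \<Longrightarrow> \<not> UNIV \<subseteq> p"
  unfolding irreducible_filters_def using filters_subset by auto

lemma irreducible_Int:
  "p \<in> irreducible_filters \<Longrightarrow> F \<in> filters \<Longrightarrow> G \<in> filters \<Longrightarrow> F \<inter> G = p \<Longrightarrow> F = p \<or> G = p"
  unfolding irreducible_filters_def by auto

lemma irreducible_Inter:
  assumes "finite E" "E \<noteq> {}" "E \<subseteq> filters" "\<Inter>E \<in> irreducible_filters"
  shows "\<Inter>E \<in> E"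
  using assms
proof (induction E rule: finite_ne_induct)
  case (insert F E)
  then have "F = \<Inter>(insert F E) \<or> \<Inter>E = \<Inter>(insert F E)"
    using irreducible_Int[OF insert.prems(2), of F "\<Inter>E"] filters_Inter[of E] by auto
  then show ?case using insert by (metis insert_iff insert_subset)
qed simp

text \<open>A filter maximal among those omitting \<open>a\<close> is irreducible: two strictly
  larger filters both contain \<open>a\<close>, hence so does their intersection.\<close>

lemma irreducible_filter_separates:
  assumes "F \<in> filters" "a \<in> carrier L" "a \<notin> F"
  obtains p where "p \<in> irreducible_filters" "F \<subseteq> p" "a \<notin> p"
proof -
  obtain p where p: "p \<in> filters" "F \<subseteq> p" "p \<inter> {a} \<subseteq> {}"
    and mx: "\<And>H. H \<in> filters \<Longrightarrow> p \<subset> H \<Longrightarrow> \<not> H \<inter> {a} \<subseteq> {}"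
    using maximal_filter_exists[OF assms(1), of "{a}" "{}"] assms(3) by blast
  have "p \<in> irreducible_filters" unfolding irreducible_filters_def
    using p mx assms(2) by (auto simp: psubset_eq)
  then show thesis using that p by blast
qed

section \<open>Closed sets of irreducible filters\<close>

text \<open>For a set \<open>A\<close> of filters, these are the irreducible members of the ideal
  generated by \<open>A\<close>: \<open>\<Inter>E \<subseteq> p\<close> says that \<open>p\<close>
  lies below the join of \<open>E\<close>.\<close>

definition cover_closure :: "'a set set \<Rightarrow> 'a set set" where
  "cover_closure A = {p \<in> irreducible_filters. \<exists>E\<subseteq>A. finite E \<and> \<Inter>E \<subseteq> p}"

definition closed_sets :: "'a set set set" where
  "closed_sets = {X. X \<subseteq> irreducible_filters \<and> cover_closure X \<subseteq> X}"

lemma cover_closureI: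
  "p \<in> irreducible_filters \<Longrightarrow> E \<subseteq> A \<Longrightarrow> finite E \<Longrightarrow> \<Inter>E \<subseteq> p \<Longrightarrow> p \<in> cover_closure A"
  unfolding cover_closure_def by blast

lemma cover_closure_extensive:
  "A \<subseteq> irreducible_filters \<Longrightarrow> A \<subseteq> cover_closure A"
  by (auto intro!: cover_closureI[of _ "{_}"])

lemma cover_closure_mono: "A \<subseteq> B \<Longrightarrow> cover_closure A \<subseteq> cover_closure B"
  unfolding cover_closure_def by blast

text \<open>Replacing each member of a finite cover by a finite cover of that member leaves a finite
  cover.\<close>

lemma cover_closure_idem: "cover_closure (cover_closure A) \<subseteq> cover_closure A"
proof
  fix p assume "p \<in> cover_closure (cover_closure A)"
  then obtain E where p: "p \<in> irreducible_filters" and E: "E \<subseteq> cover_closure A" "finite E" "\<Inter>E \<subseteq> p"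
    unfolding cover_closure_def by blast
  have "\<forall>e\<in>E. \<exists>F\<subseteq>A. finite F \<and> \<Inter>F \<subseteq> e" using E unfolding cover_closure_def by blast
  then obtain F where F: "\<And>e. e \<in> E \<Longrightarrow> F e \<subseteq> A \<and> finite (F e) \<and> \<Inter>(F e) \<subseteq> e" by metis
  have "\<Inter>(\<Union>(F ` E)) \<subseteq> \<Inter>E"
  proof (rule Inter_greatest)
    fix e assume e: "e \<in> E"
    then have "\<Inter>(\<Union>(F ` E)) \<subseteq> \<Inter>(F e)" by (intro Inter_anti_mono) auto
    then show "\<Inter>(\<Union>(F ` E)) \<subseteq> e" using F[OF e] by (meson order_trans)
  qed
  moreover have "\<Union>(F ` E) \<subseteq> A" using F by (simp add: UN_least)
  moreover have "finite (\<Union>(F ` E))" using F E(2) by simp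
  ultimately show "p \<in> cover_closure A" using p E(3) by (meson cover_closureI order_trans)
qed

lemma cover_closure_closed: "cover_closure A \<in> closed_sets"
  using cover_closure_idem unfolding closed_sets_def by (auto simp: cover_closure_def)

lemma cover_closure_least: "X \<in> closed_sets \<Longrightarrow> A \<subseteq> X \<Longrightarrow> cover_closure A \<subseteq> X"
  using cover_closure_mono unfolding closed_sets_def by blast

lemma closed_sets_irreducible: "X \<in> closed_sets \<Longrightarrow> X \<subseteq> irreducible_filters"
  by (simp add: closed_sets_def)

lemma closed_setsD:
  "X \<in> closed_sets \<Longrightarrow> p \<in> irreducible_filters \<Longrightarrow> E \<subseteq> X \<Longrightarrow> finite E \<Longrightarrow> \<Inter>E \<subseteq> p \<Longrightarrow> p \<in> X"
  unfolding closed_sets_def by (blast intro: cover_closureI)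

text \<open>The case \<open>E = {}\<close> may be dropped because the empty family covers no
  irreducible filter.\<close>

lemma closed_setsI:
  assumes "X \<subseteq> irreducible_filters"
    "\<And>p E. p \<in> irreducible_filters \<Longrightarrow> E \<subseteq> X \<Longrightarrow> finite E \<Longrightarrow> E \<noteq> {} \<Longrightarrow> \<Inter>E \<subseteq> p \<Longrightarrow> p \<in> X"
  shows "X \<in> closed_sets"
  using assms irreducible_not_UNIV unfolding closed_sets_def cover_closure_def
  by (auto) (metis Inter_empty)

lemma closed_sets_Int: "X \<in> closed_sets \<Longrightarrow> Y \<in> closed_sets \<Longrightarrow> X \<inter> Y \<in> closed_sets"
  by (rule closed_setsI) (auto dest: closed_sets_irreducible intro: closed_setsD)

section \<open>The complete lattice of closed sets\<close>

definition closed_lattice :: "'a set set gorder" where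
  "closed_lattice = \<lparr>carrier = closed_sets, eq = (=), le = (\<subseteq>)\<rparr>"

lemma closed_lattice_simps [simp]:
  "carrier closed_lattice = closed_sets" "le closed_lattice = (\<subseteq>)" "eq closed_lattice = (=)"
  by (simp_all add: closed_lattice_def)

lemma lless_closed_lattice [simp]: "X \<sqsubset>\<^bsub>closed_lattice\<^esub> Y \<longleftrightarrow> X \<subset> Y"
  by (auto simp: lless_def)

lemma partial_order_closed_lattice: "partial_order closed_lattice"
  by unfold_locales auto

lemma is_lub_closed_lattice:
  assumes "A \<subseteq> closed_sets"
  shows "is_lub closed_lattice s A \<longleftrightarrow> s = cover_closure (\<Union>A)"
proof -
  interpret M: partial_order closed_lattice by (rule partial_order_closed_lattice)
  have "\<Union>A \<subseteq> cover_closure (\<Union>A)"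
    using assms closed_sets_irreducible by (intro cover_closure_extensive) blast
  have "is_lub closed_lattice (cover_closure (\<Union>A)) A"
  proof (rule least_UpperI)
    show "X \<sqsubseteq>\<^bsub>closed_lattice\<^esub> cover_closure (\<Union>A)" if "X \<in> A" for X
      using \<open>\<Union>A \<subseteq> cover_closure (\<Union>A)\<close> that by auto
    show "cover_closure (\<Union>A) \<sqsubseteq>\<^bsub>closed_lattice\<^esub> Y" if "Y \<in> Upper closed_lattice A" for Y
    proof -
      have "Y \<in> closed_sets" "\<Union>A \<subseteq> Y" using that assms unfolding Upper_def by auto
      then show ?thesis by (simp add: cover_closure_least)
    qed
  qed (use assms cover_closure_closed in auto)
  then show ?thesis using M.least_unique by blast
qed

lemma is_glb_closed_lattice:
  assumes "A \<subseteq> closed_sets" "A \<noteq> {}"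
  shows "is_glb closed_lattice (\<Inter>A) A"
proof -
  have "\<Inter>A \<in> closed_sets"
  proof (rule closed_setsI)
    show "\<Inter>A \<subseteq> irreducible_filters" using assms closed_sets_irreducible by blast
    show "p \<in> \<Inter>A" if "p \<in> irreducible_filters" "E \<subseteq> \<Inter>A" "finite E" "\<Inter>E \<subseteq> p" for p E
      using that assms by (meson InterI Inter_lower closed_setsD order_trans subsetD)
  qed
  then show ?thesis using assms(1) unfolding greatest_def Lower_def by auto
qed

lemma complete_closed_lattice: "complete_lattice closed_lattice"
proof (rule partial_order.complete_lattice_criterion1[OF partial_order_closed_lattice])
  have "irreducible_filters \<in> closed_sets" by (rule closed_setsI) auto
  then show "\<exists>g. greatest closed_lattice g (carrier closed_lattice)"
    unfolding greatest_def using closed_sets_irreducible by auto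
qed (use is_glb_closed_lattice in auto)

lemma join_closed_lattice:
  assumes "X \<in> closed_sets" "Y \<in> closed_sets"
  shows "X \<squnion>\<^bsub>closed_lattice\<^esub> Y = cover_closure (X \<union> Y)"
proof -
  interpret M: complete_lattice closed_lattice by (rule complete_closed_lattice)
  show ?thesis
    using M.sup_of_two_least[of X Y] assms is_lub_closed_lattice[of "{X, Y}"]
    unfolding join_def by simp
qed

lemma meet_closed_lattice:
  assumes "X \<in> closed_sets" "Y \<in> closed_sets"
  shows "X \<sqinter>\<^bsub>closed_lattice\<^esub> Y = X \<inter> Y"
proof -
  interpret M: complete_lattice closed_lattice by (rule complete_closed_lattice)
  show ?thesis
    using M.inf_of_two_greatest[of X Y] assms is_glb_closed_lattice[of "{X, Y}"] M.greatest_unique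
    unfolding meet_def by auto
qed

section \<open>Algebraicity and points\<close>

text \<open>For irreducible \<open>p\<close>, the least closed set containing \<open>p\<close>: its
  down-set with respect to reverse inclusion.\<close>

definition principal :: "'a set \<Rightarrow> 'a set set" where
  "principal p = {q \<in> irreducible_filters. p \<subseteq> q}"

lemma principal_closed: "principal p \<in> closed_sets"
  by (rule closed_setsI) (auto simp: principal_def)

lemma principal_refl: "p \<in> irreducible_filters \<Longrightarrow> p \<in> principal p"
  by (simp add: principal_def)

lemma principal_subset: "X \<in> closed_sets \<Longrightarrow> p \<in> X \<Longrightarrow> principal p \<subseteq> X"
  unfolding principal_def by (auto intro: closed_setsD[of _ _ "{p}"])

text \<open>Gives join-density both of the compact elements and of the points, once the sets
  \<open>principal p\<close> are known to be such.\<close>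

lemma is_lub_principal:
  assumes "X \<in> closed_sets" shows "is_lub closed_lattice X (principal ` X)"
proof -
  have "\<Union>(principal ` X) = X"
    using principal_subset[OF assms] principal_refl closed_sets_irreducible[OF assms] by blast
  moreover have "cover_closure X = X"
    using assms cover_closure_extensive closed_sets_def by blast
  ultimately show ?thesis
    using is_lub_closed_lattice[of "principal ` X"] by (simp add: image_subset_iff principal_closed)
qed

lemma directed_finite_subset:
  assumes "directed closed_lattice D" "D \<noteq> {}" "finite E" "E \<subseteq> \<Union>D"
  shows "\<exists>d\<in>D. E \<subseteq> d"
  using assms(3,4)
proof (induction E rule: finite_induct)
  case (insert x E)
  then obtain d e where de: "d \<in> D" "E \<subseteq> d" "e \<in> D" "x \<in> e" by auto
  then obtain z where "z \<in> D" "d \<subseteq> z" "e \<subseteq> z"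
    using assms(1) unfolding directed_def closed_lattice_simps by meson
  then show ?case using de by blast
qed (use assms(2) in blast)

text \<open>If \<open>p\<close> lies in the closure of a directed union, then already a finite
  \<open>E\<close> covers it; directedness places \<open>E\<close> inside one closed member, which
  then contains \<open>p\<close>.\<close>

lemma principal_compact:
  assumes "p \<in> irreducible_filters"
  shows "principal p \<in> compact_elements closed_lattice"
  unfolding compact_elements_def
proof (clarsimp simp: principal_closed)
  fix D s assume D: "D \<subseteq> closed_sets" "D \<noteq> {}" "directed closed_lattice D"
    and s: "is_lub closed_lattice s D" "principal p \<subseteq> s"
  have "p \<in> cover_closure (\<Union>D)"
    using s principal_refl[OF assms] is_lub_closed_lattice[OF D(1)] by blast
  then obtain E where "E \<subseteq> \<Union>D" "finite E" "\<Inter>E \<subseteq> p" unfolding cover_closure_def by blast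
  then show "\<exists>d\<in>D. principal p \<subseteq> d"
    using directed_finite_subset[OF D(3,2)] D(1) assms
    by (meson closed_setsD principal_subset subsetD)
qed

lemma algebraic_closed_lattice: "algebraic_lattice closed_lattice"
  unfolding algebraic_lattice_def join_dense_def
proof (intro conjI ballI complete_closed_lattice)
  show "compact_elements closed_lattice \<subseteq> carrier closed_lattice"
    unfolding compact_elements_def by blast
  fix X assume "X \<in> carrier closed_lattice"
  then have X: "X \<in> closed_sets" by simp
  then show "\<exists>A\<subseteq>compact_elements closed_lattice. is_lub closed_lattice X A"
    using is_lub_principal[OF X] principal_compact closed_sets_irreducible[OF X] by blast
qed

lemma principal_point:
  assumes p: "p \<in> irreducible_filters"
  shows "principal p \<in> points closed_lattice"
proof -
  \<comment> \<open>The candidate for the lower cover is \<open>principal p\<close> without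
    \<open>p\<close>. It is closed because, by irreducibility, finitely many filters strictly
    containing \<open>p\<close> cannot intersect in \<open>p\<close>.\<close>
  let ?Q = "{q \<in> irreducible_filters. p \<subset> q}"
  have "?Q \<in> closed_sets"
  proof (rule closed_setsI)
    fix q E assume q: "q \<in> irreducible_filters" and E: "E \<subseteq> ?Q" "finite E" "E \<noteq> {}" "\<Inter>E \<subseteq> q"
    have "p \<notin> E" using E by blast
    moreover have "E \<subseteq> filters" using E irreducible_filter by blast
    ultimately have "\<Inter>E \<noteq> p" using irreducible_Inter[of E] E p by metis
    moreover have "p \<subseteq> \<Inter>E" using E by blast
    ultimately show "q \<in> ?Q" using E q by blast
  qed auto
  moreover have "?Q \<subset> principal p" using p unfolding principal_def by blast
  moreover have "X \<subseteq> ?Q" if "X \<in> closed_sets" "X \<subset> principal p" for X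
    using principal_subset[of X p] that unfolding principal_def by blast
  ultimately have "greatest closed_lattice ?Q {X \<in> carrier closed_lattice. X \<sqsubset>\<^bsub>closed_lattice\<^esub> principal p}"
    unfolding greatest_def by auto
  then show ?thesis unfolding points_def using principal_closed by auto
qed

text \<open>If \<open>Q\<close> is the largest closed set strictly below \<open>X\<close> and
  \<open>p \<in> X - Q\<close>, then \<open>principal p\<close> is below \<open>X\<close> but not
  below \<open>Q\<close>, hence equals \<open>X\<close>.\<close>

lemma points_closed_lattice: "points closed_lattice = principal ` irreducible_filters"
proof
  show "principal ` irreducible_filters \<subseteq> points closed_lattice" using principal_point by blast
  show "points closed_lattice \<subseteq> principal ` irreducible_filters"
  proof
    fix X assume "X \<in> points closed_lattice"
    then obtain Q where X: "X \<in> closed_sets" and Q: "Q \<in> closed_sets" "Q \<subset> X"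
      and mx: "\<And>Y. Y \<in> closed_sets \<Longrightarrow> Y \<subset> X \<Longrightarrow> Y \<subseteq> Q"
      unfolding points_def greatest_def by auto
    obtain p where p: "p \<in> X" "p \<notin> Q" using Q by blast
    then have i: "p \<in> irreducible_filters" using closed_sets_irreducible[OF X] by blast
    have "principal p = X"
      using mx[OF principal_closed, of p] principal_subset[OF X p(1)] principal_refl[OF i] p(2) by blast
    then show "X \<in> principal ` irreducible_filters" using i by blast
  qed
qed

text \<open>Translates covers of a point of \<open>closed_lattice\<close> into finite covers of
  \<open>p\<close> by filters, where the combinatorial work takes place.\<close>

lemma join_cover_closed_lattice:
  assumes "p \<in> irreducible_filters"
  shows "join_cover closed_lattice (principal p) A \<longleftrightarrow>
    finite A \<and> A \<subseteq> closed_sets \<and> (\<exists>E\<subseteq>\<Union>A. finite E \<and> \<Inter>E \<subseteq> p)" (is "_ = ?R")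
proof -
  have "join_cover closed_lattice (principal p) A \<longleftrightarrow>
    finite A \<and> A \<subseteq> closed_sets \<and> principal p \<subseteq> cover_closure (\<Union>A)"
    unfolding join_cover_def using is_lub_closed_lattice[of A] by auto
  moreover have "principal p \<subseteq> cover_closure (\<Union>A) \<longleftrightarrow> p \<in> cover_closure (\<Union>A)"
    using principal_subset[OF cover_closure_closed] principal_refl[OF assms] by blast
  ultimately show ?thesis using assms unfolding cover_closure_def by auto
qed

end

section \<open>Minimal covers in the presence of \<open>n\<close>-distributivity\<close>

locale n_distributive_lattice = lattice L for L :: "'a gorder" (structure) +
  fixes n :: nat
  assumes n_pos: "n > 0" and n_distr: "n_distributive n L"
begin

text \<open>The members may be arbitrary filters, since enlarging or splitting a member need not
  yield irreducible ones.\<close>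

definition irredundant_cover :: "'a set \<Rightarrow> 'a set set \<Rightarrow> bool" where
  "irredundant_cover p E \<longleftrightarrow> finite E \<and> E \<subseteq> filters \<and> \<Inter>E \<subseteq> p \<and> (\<forall>e\<in>E. \<not> \<Inter>(E - {e}) \<subseteq> p)"

text \<open>Suppose there are more than \<open>n\<close> members and distribute them into
  \<open>n + 1\<close> nonempty blocks; let \<open>X i\<close> be the join of the members outside
  block \<open>i\<close>. By \<open>n\<close>-distributivity \<open>p\<close> is the join of its
  meets with the \<open>X i\<close>, so irreducibility puts \<open>p\<close> below some
  \<open>X i\<close>, against irredundance.\<close>

lemma irredundant_cover_card:
  assumes p: "p \<in> irreducible_filters" and E: "irredundant_cover p E"
  shows "card E \<le> n"
proof (rule ccontr)
  assume "\<not> card E \<le> n"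
  then have big: "n < card E" by simp
  have fin: "finite E" and Ef: "E \<subseteq> filters" and cov: "\<Inter>E \<subseteq> p"
    and irr: "\<And>e. e \<in> E \<Longrightarrow> \<not> \<Inter>(E - {e}) \<subseteq> p"
    using E unfolding irredundant_cover_def by auto
  have pf: "p \<in> filters" by (rule irreducible_filter[OF p])
  obtain h where h: "bij_betw h E {0..<card E}" using ex_bij_betw_finite_nat[OF fin] by blast
  \<comment> \<open>The block number of \<open>e\<close>; block \<open>n\<close> collects all
    surplus members.\<close>
  define g where "g e = min (h e) n" for e
  have g: "\<exists>e\<in>E. g e = i" if "i \<le> n" for i
  proof -
    have "i \<in> h ` E" using h that big unfolding bij_betw_def by auto
    then obtain e where "e \<in> E" "h e = i" by blast
    then show ?thesis using that unfolding g_def by (intro bexI[of _ e]) auto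
  qed
  define X where "X i = \<Inter>{e \<in> E. g e \<noteq> i}" for i
  have X: "X i \<in> filters" if "i \<le> n" for i
  proof -
    \<comment> \<open>A second block exists as \<open>n > 0\<close>, so \<open>X i\<close> is an
      intersection over a nonempty family and thus a filter.\<close>
    obtain j where "j \<le> n" "j \<noteq> i" using n_pos by (metis le0 less_irrefl order_refl)
    then have "{e \<in> E. g e \<noteq> i} \<noteq> {}" using g by blast
    then show ?thesis unfolding X_def using fin Ef by (intro filters_Inter) auto
  qed
  have Xp: "\<not> X i \<subseteq> p" if "i \<le> n" for i
  proof -
    obtain e where e: "e \<in> E" "g e = i" using g \<open>i \<le> n\<close> by blast
    then have "\<Inter>(E - {e}) \<subseteq> X i" unfolding X_def by blast
    then show ?thesis using irr[OF e(1)] by blast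
  qed
  define Q where "Q i = filter_join p (X i)" for i
  have Q: "Q i \<in> filters" "p \<subseteq> Q i" "X i \<subseteq> Q i" if "i \<le> n" for i
    using filter_join_filters filter_join_upper pf X that unfolding Q_def by auto
  have "\<Inter>(Q ` {..n}) \<subseteq> p"
  proof
    fix c assume c: "c \<in> \<Inter>(Q ` {..n})"
    then have "\<forall>i\<in>{..n}. \<exists>a b. a \<in> p \<and> b \<in> X i \<and> a \<sqinter> b \<sqsubseteq> c"
      unfolding Q_def filter_join_def by blast
    then obtain a b where ab: "\<And>i. i \<le> n \<Longrightarrow> a i \<in> p" "\<And>i. i \<le> n \<Longrightarrow> b i \<in> X i"
      "\<And>i. i \<le> n \<Longrightarrow> a i \<sqinter> b i \<sqsubseteq> c" by (metis atMost_iff)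
    have cL: "c \<in> carrier L" using c filters_mem[OF Q(1), of 0] by auto
    have aL: "a i \<in> carrier L" and bL: "b i \<in> carrier L" if "i \<le> n" for i
      using ab that X pf filters_mem by blast+
    \<comment> \<open>A single element of \<open>p\<close> that can replace every
      \<open>a i\<close>.\<close>
    define a0 where "a0 = \<Sqinter>(a ` {..n})"
    have a0: "a0 \<in> p" "a0 \<in> carrier L"
      unfolding a0_def using filters_finite_inf[OF pf, of "a ` {..n}"] ab(1) pf filters_mem by auto
    have a0le: "a0 \<sqsubseteq> a i" if "i \<le> n" for i
      unfolding a0_def using aL that by (intro finite_inf_lower) auto
    \<comment> \<open>Chosen for two properties: \<open>y j\<close> belongs to every member of block
      \<open>j\<close>, so the join of all \<open>y j\<close> lies in \<open>\<Inter>E\<close>; and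
      \<open>y j \<sqsubseteq> b i\<close> for \<open>j \<noteq> i\<close>, so each term on the
      right of the distributive identity is below some \<open>a i \<sqinter> b i\<close>, hence
      below \<open>c\<close>.\<close>
    define y where "y j = \<Sqinter>(b ` ({..n} - {j}))" for j
    have ne: "{..n} - {j} \<noteq> {}" for j
      using n_pos by (metis Diff_eq_empty_iff atMost_iff le0 less_irrefl order_refl singletonD subsetD)
    have yL: "y j \<in> carrier L" for j
      unfolding y_def using bL ne by (intro finite_inf_closed) auto
    have yb: "y j \<sqsubseteq> b i" if "i \<le> n" "j \<noteq> i" for i j
      unfolding y_def using bL that by (intro finite_inf_lower) auto
    have ye: "y (g e) \<in> e" if "e \<in> E" for e
      unfolding y_def
    proof (rule filters_finite_inf)
      show "b ` ({..n} - {g e}) \<subseteq> e" using ab(2) that unfolding X_def by blast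
    qed (use that Ef ne in auto)
    have sL: "\<Squnion>(y ` {..n}) \<in> carrier L" using yL by (intro finite_sup_closed) auto
    have "\<Squnion>(y ` {..n}) \<in> e" if "e \<in> E" for e
    proof (rule filters_up[OF _ ye[OF that] sL])
      show "y (g e) \<sqsubseteq> \<Squnion>(y ` {..n})" using yL unfolding g_def by (intro finite_sup_upper) auto
    qed (use that Ef in auto)
    then have "a0 \<sqinter> \<Squnion>(y ` {..n}) \<in> p" using cov a0 pf filters_meet by blast
    moreover have "a0 \<sqinter> \<Squnion>(y ` {..n}) =
        \<Squnion>((\<lambda>i. a0 \<sqinter> \<Squnion>(y ` ({..n} - {i}))) ` {..n})"
      using n_distr a0(2) yL unfolding n_distributive_def by blast
    moreover have "\<Squnion>((\<lambda>i. a0 \<sqinter> \<Squnion>(y ` ({..n} - {i}))) ` {..n}) \<sqsubseteq> c"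
    proof -
      have tL: "\<Squnion>(y ` ({..n} - {i})) \<in> carrier L" for i
        using yL ne by (intro finite_sup_closed) auto
      have "a0 \<sqinter> \<Squnion>(y ` ({..n} - {i})) \<sqsubseteq> c" if "i \<le> n" for i
      proof -
        have "\<Squnion>(y ` ({..n} - {i})) \<sqsubseteq> b i"
          using yL ne yb that bL by (intro finite_sup_le) auto
        then have "a0 \<sqinter> \<Squnion>(y ` ({..n} - {i})) \<sqsubseteq> a i \<sqinter> b i"
          using that a0 a0le tL aL bL by (intro meet_mono) auto
        then show ?thesis
          using le_trans[OF _ ab(3)[OF that]] that a0 tL aL bL cL by simp
      qed
      then show ?thesis using a0 tL cL by (intro finite_sup_le) auto
    qed
    ultimately show "c \<in> p" using pf filters_up cL by metis
  qed
  then have "\<Inter>(Q ` {..n}) = p" using Q(2) by blast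
  then have "p \<in> Q ` {..n}"
    using irreducible_Inter[of "Q ` {..n}"] Q(1) p by auto
  then obtain i where "i \<le> n" "Q i = p" by auto
  then show False using Q(3) Xp by metis
qed

lemma irredundant_subcover_exists:
  assumes "finite E" "E \<subseteq> filters" "\<Inter>E \<subseteq> p"
  obtains E' where "E' \<subseteq> E" "irredundant_cover p E'"
proof -
  have "\<exists>E'\<subseteq>E. irredundant_cover p E'" using assms
  proof (induction "card E" arbitrary: E rule: less_induct)
    case less
    show ?case
    proof (cases "\<exists>e\<in>E. \<Inter>(E - {e}) \<subseteq> p")
      case True
      then obtain e where e: "e \<in> E" "\<Inter>(E - {e}) \<subseteq> p" by blast
      with less.prems have "card (E - {e}) < card E" by (meson card_Diff1_less)
      then obtain E' where "E' \<subseteq> E - {e}" "irredundant_cover p E'"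
        using less.hyps[of "E - {e}"] less.prems e by auto
      then show ?thesis by blast
    next
      case False
      then have "irredundant_cover p E" using less.prems unfolding irredundant_cover_def by simp
      then show ?thesis by blast
    qed
  qed
  then show thesis using that by blast
qed

text \<open>A cover with as many maximal members as possible, among the longest ones, has only maximal
  members: enlarging one member keeps the maximality of the others.\<close>

lemma optimal_cover_exists:
  assumes p: "p \<in> irreducible_filters" and A: "finite A" "A \<subseteq> filters" "\<Inter>A \<subseteq> p"
  obtains E where "irredundant_cover p E" "\<forall>e\<in>E. \<exists>f\<in>A. f \<subseteq> e"
    "\<And>E'. irredundant_cover p E' \<Longrightarrow> \<forall>e\<in>E'. \<exists>f\<in>A. f \<subseteq> e \<Longrightarrow> card E' \<le> card E"
    "\<And>e G. e \<in> E \<Longrightarrow> G \<in> filters \<Longrightarrow> e \<subset> G \<Longrightarrow> \<not> G \<inter> \<Inter>(E - {e}) \<subseteq> p"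
proof -
  define C where "C E \<longleftrightarrow> irredundant_cover p E \<and> (\<forall>e\<in>E. \<exists>f\<in>A. f \<subseteq> e)" for E
  obtain E1 where "E1 \<subseteq> A" "irredundant_cover p E1" using irredundant_subcover_exists[OF A] by blast
  then have "C E1" unfolding C_def by blast
  moreover have "\<forall>E. C E \<longrightarrow> card E < Suc n"
    using irredundant_cover_card[OF p] by (simp add: C_def less_Suc_eq_le)
  ultimately have "\<exists>E. C E \<and> (\<forall>E'. C E' \<longrightarrow> card E' \<le> card E)"
    by (rule Lattices_Big.ex_has_greatest_nat)
  then obtain E0 where E0: "C E0" "\<And>E. C E \<Longrightarrow> card E \<le> card E0" by blast
  \<comment> \<open>The members that no strictly larger filter can replace. Their number is
    maximized second, among the covers of maximal length; it is bounded by that length.\<close>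
  define good where "good E = {e \<in> E. \<forall>G\<in>filters. e \<subset> G \<longrightarrow> \<not> G \<inter> \<Inter>(E - {e}) \<subseteq> p}" for E
  let ?C = "\<lambda>E. C E \<and> card E = card E0"
  have "\<forall>E. ?C E \<longrightarrow> card (good E) < Suc (card E0)"
  proof (intro allI impI)
    fix E assume E: "?C E"
    then have "finite E" unfolding C_def irredundant_cover_def by simp
    then have "card (good E) \<le> card E" unfolding good_def by (intro card_mono) auto
    then show "card (good E) < Suc (card E0)" using E by simp
  qed
  moreover have "?C E0" using E0(1) by simp
  ultimately have "\<exists>E. ?C E \<and> (\<forall>E'. ?C E' \<longrightarrow> card (good E') \<le> card (good E))"
    by (rule Lattices_Big.ex_has_greatest_nat[rotated])
  then obtain E where E: "C E" "card E = card E0"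
    and mx: "\<And>E'. C E' \<Longrightarrow> card E' = card E0 \<Longrightarrow> card (good E') \<le> card (good E)"
    by blast
  have fin: "finite E" and Ef: "E \<subseteq> filters" and cov: "\<Inter>E \<subseteq> p"
    and irr: "\<And>e. e \<in> E \<Longrightarrow> \<not> \<Inter>(E - {e}) \<subseteq> p" and ref: "\<And>e. e \<in> E \<Longrightarrow> \<exists>f\<in>A. f \<subseteq> e"
    using E(1) unfolding C_def irredundant_cover_def by auto
  have "e \<in> good E" if e: "e \<in> E" for e
  proof (rule ccontr)
    assume ng: "e \<notin> good E"
    have "e \<inter> \<Inter>(E - {e}) \<subseteq> p" using cov e by blast
    then obtain d where d: "d \<in> filters" "e \<subseteq> d" "d \<inter> \<Inter>(E - {e}) \<subseteq> p"
      and dm: "\<And>H. H \<in> filters \<Longrightarrow> d \<subset> H \<Longrightarrow> \<not> H \<inter> \<Inter>(E - {e}) \<subseteq> p"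
      using maximal_filter_exists[OF subsetD[OF Ef e]] by metis
    \<comment> \<open>Were \<open>d\<close> another member of \<open>E\<close>, the cover without
      \<open>e\<close> would already suffice. Hence the exchange of \<open>e\<close> for
      \<open>d\<close> preserves the length.\<close>
    have dn: "d \<notin> E - {e}"
    proof
      assume "d \<in> E - {e}"
      then have "\<Inter>(E - {e}) \<subseteq> d" by blast
      then show False using d(3) irr[OF e] by blast
    qed
    let ?E = "insert d (E - {e})"
    have Ed: "?E - {d} = E - {e}" using dn by blast
    \<comment> \<open>Enlarging \<open>e\<close> only enlarges what the other members are tested
      against, so they stay irredundant and good.\<close>
    have sup: "\<Inter>(E - {f}) \<subseteq> \<Inter>(?E - {f})" if "f \<in> E - {e}" for f
      using that e d(2) dn by blast
    have "irredundant_cover p ?E"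
    proof (unfold irredundant_cover_def, intro conjI ballI)
      show "\<Inter>?E \<subseteq> p" using d(3) by simp
      fix f assume "f \<in> ?E"
      then consider "f = d" | "f \<in> E - {e}" by blast
      then show "\<not> \<Inter>(?E - {f}) \<subseteq> p"
      proof cases
        case 1 then show ?thesis using Ed irr[OF e] by simp
      next
        case 2
        then have "\<not> \<Inter>(E - {f}) \<subseteq> p" by (intro irr) simp
        then show ?thesis using sup[OF 2] by (meson order_trans)
      qed
    qed (use fin Ef d in auto)
    moreover have "\<forall>f\<in>?E. \<exists>h\<in>A. h \<subseteq> f" 
    proof
      fix f assume "f \<in> ?E"
      then show "\<exists>h\<in>A. h \<subseteq> f" using ref[of f] ref[OF e] d(2) by auto
    qed
    ultimately have "C ?E" unfolding C_def by blast
    moreover have card: "card ?E = card E0"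
      using dn fin e E(2) by (simp add: card.insert_remove card_Suc_Diff1 del: card_Diff_insert)
    ultimately have le: "card (good ?E) \<le> card (good E)" by (rule mx)
    have "d \<in> good ?E" unfolding good_def using dm Ed by simp
    moreover have "f \<in> good ?E" if "f \<in> good E" for f
    proof -
      have "f \<noteq> e" "f \<in> E" using that ng good_def by auto
      then have sub: "\<Inter>(E - {f}) \<subseteq> \<Inter>(?E - {f})" by (intro sup) simp
      have "\<not> G \<inter> \<Inter>(?E - {f}) \<subseteq> p" if G: "G \<in> filters" "f \<subset> G" for G
      proof -
        have "\<not> G \<inter> \<Inter>(E - {f}) \<subseteq> p" using \<open>f \<in> good E\<close> G by (simp add: good_def)
        then show ?thesis using sub by (meson Int_mono order_refl order_trans)
      qed
      then show ?thesis using \<open>f \<noteq> e\<close> \<open>f \<in> E\<close> by (simp add: good_def)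
    qed
    ultimately have "insert d (good E) \<subseteq> good ?E" by blast
    \<comment> \<open>The only member of \<open>E\<close> that \<open>d\<close> could be is
      \<open>e\<close>, which is not good; so the exchange gains a good member.\<close>
    moreover have "d \<notin> good E" using dn ng unfolding good_def by blast
    moreover have "finite (good E)" "finite (good ?E)" using fin unfolding good_def by auto
    ultimately have "Suc (card (good E)) \<le> card (good ?E)" by (metis card_insert_disjoint card_mono)
    then show False using le by simp
  qed
  then show thesis using that[of E] E E0(2) unfolding C_def good_def by force
qed

text \<open>The last conclusion gives minimality: the members of \<open>Y\<close> containing a given
  \<open>e \<in> E\<close> can jointly replace \<open>e\<close>, so by maximality of
  \<open>e\<close> they intersect exactly in \<open>e\<close>, and by irreducibility one of them is
  \<open>e\<close>.\<close>

lemma minimal_cover_exists: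
  assumes p: "p \<in> irreducible_filters" and A: "finite A" "A \<subseteq> filters" "\<Inter>A \<subseteq> p"
  obtains E where "irredundant_cover p E" "E \<subseteq> irreducible_filters" "\<forall>e\<in>E. \<exists>f\<in>A. f \<subseteq> e"
    "\<And>Y. finite Y \<Longrightarrow> Y \<subseteq> filters \<Longrightarrow> \<Inter>Y \<subseteq> p \<Longrightarrow> \<forall>y\<in>Y. \<exists>e\<in>E. e \<subseteq> y \<Longrightarrow> E \<subseteq> Y"
proof -
  obtain E where E: "irredundant_cover p E" and ref: "\<forall>e\<in>E. \<exists>f\<in>A. f \<subseteq> e"
    and card: "\<And>E'. irredundant_cover p E' \<Longrightarrow> \<forall>e\<in>E'. \<exists>f\<in>A. f \<subseteq> e \<Longrightarrow> card E' \<le> card E"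
    and mx: "\<And>e G. e \<in> E \<Longrightarrow> G \<in> filters \<Longrightarrow> e \<subset> G \<Longrightarrow> \<not> G \<inter> \<Inter>(E - {e}) \<subseteq> p"
    using optimal_cover_exists[OF assms] by blast
  have fin: "finite E" and Ef: "E \<subseteq> filters" and cov: "\<Inter>E \<subseteq> p"
    and irr: "\<And>e. e \<in> E \<Longrightarrow> \<not> \<Inter>(E - {e}) \<subseteq> p"
    using E unfolding irredundant_cover_def by auto
  have Ei: "E \<subseteq> irreducible_filters"
  proof
    fix e assume e: "e \<in> E"
    then have ef: "e \<in> filters" using Ef by blast
    have "e \<noteq> carrier L"
    proof
      assume eL: "e = carrier L"
      show False
      \<comment> \<open>If other members exist, they make \<open>carrier L\<close> redundant. If
        not, their intersection is \<open>UNIV\<close>, and instead \<open>p\<close> itself would be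
        all of \<open>carrier L\<close>.\<close>
      proof (cases "E - {e} = {}")
        case True
        then have "carrier L \<subseteq> p" using cov eL e by (metis Diff_eq_empty_iff Inter_lower cInf_singleton order_trans subset_singleton_iff empty_iff)
        then show False using p filters_subset[OF irreducible_filter[OF p]]
          unfolding irreducible_filters_def by blast
      next
        case False
        then have "\<Inter>(E - {e}) \<subseteq> carrier L" using Ef filters_subset by blast
        then have "\<Inter>(E - {e}) \<subseteq> \<Inter>E" using eL by blast
        then show False using cov irr[OF e] by blast
      qed
    qed
    moreover have "e = G \<or> e = H" if GH: "G \<in> filters" "H \<in> filters" "e = G \<inter> H" for G H
    proof (rule ccontr)
      assume "\<not> (e = G \<or> e = H)"
      then have lt: "e \<subset> G" "e \<subset> H" "G \<noteq> H" using GH(3) by auto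
      let ?D = "\<Inter>(E - {e})"
      \<comment> \<open>By maximality of \<open>e\<close> neither factor alone can replace it, so
        both are needed in the split cover.\<close>
      have nG: "\<not> G \<inter> ?D \<subseteq> p" "\<not> H \<inter> ?D \<subseteq> p" using mx[OF e] GH lt by auto
      have GHD: "G \<inter> H \<inter> ?D \<subseteq> p" using cov e GH(3) by blast
      \<comment> \<open>If \<open>G\<close> were in \<open>E\<close>, then
        \<open>?D \<subseteq> G\<close> and \<open>H\<close> alone could replace \<open>e\<close>;
        likewise for \<open>H\<close>. This makes the split cover longer by exactly one.\<close>
      have out: "G \<notin> E" "H \<notin> E"
      proof -
        show "G \<notin> E"
        proof
          assume "G \<in> E"
          then have "?D \<subseteq> G" using lt by blast
          then show False using GHD nG(2) by blast
        qed
        show "H \<notin> E"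
        proof
          assume "H \<in> E"
          then have "?D \<subseteq> H" using lt by blast
          then show False using GHD nG(1) by blast
        qed
      qed
      let ?E = "insert G (insert H (E - {e}))"
      have "irredundant_cover p ?E" unfolding irredundant_cover_def
      proof (intro conjI ballI)
        show "\<Inter>?E \<subseteq> p" using GHD by (simp add: Int_assoc)
        fix f assume "f \<in> ?E"
        then consider "f = G" | "f = H" | "f \<in> E" "f \<noteq> e" "f \<noteq> G" "f \<noteq> H" using out by blast
        then show "\<not> \<Inter>(?E - {f}) \<subseteq> p"
        proof cases
          case 1
          have "H \<inter> ?D \<subseteq> \<Inter>(?E - {f})" using 1 by blast
          then show ?thesis using nG(2) by blast
        next
          case 2
          have "G \<inter> ?D \<subseteq> \<Inter>(?E - {f})" using 2 by blast
          then show ?thesis using nG(1) by blast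
        next
          case 3
          have "\<Inter>(E - {f}) \<subseteq> \<Inter>(?E - {f})" using 3 lt e by blast
          then show ?thesis using irr[OF 3(1)] by (meson order_trans)
        qed
      qed (use fin Ef GH in auto)
      moreover have "\<forall>f\<in>?E. \<exists>h\<in>A. h \<subseteq> f" 
      proof
        fix f assume "f \<in> ?E"
        then have "f \<in> E \<or> e \<subseteq> f" using lt by blast
        then show "\<exists>h\<in>A. h \<subseteq> f" using ref e by (meson order_trans)
      qed
      ultimately have "card ?E \<le> card E" by (rule card)
      moreover have "card ?E = Suc (Suc (card (E - {e})))" using fin out lt by simp
      moreover have "Suc (card (E - {e})) = card E" using fin e by (rule card_Suc_Diff1)
      ultimately show False by simp
    qed
    ultimately show "e \<in> irreducible_filters" using ef unfolding irreducible_filters_def by blast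
  qed
  have "E \<subseteq> Y" if Y: "finite Y" "Y \<subseteq> filters" "\<Inter>Y \<subseteq> p" and r: "\<forall>y\<in>Y. \<exists>e\<in>E. e \<subseteq> y" for Y
  proof
    fix e assume e: "e \<in> E"
    let ?Y = "{y \<in> Y. e \<subseteq> y}"
    have bd: "\<Inter>?Y \<inter> \<Inter>(E - {e}) \<subseteq> p"
    proof
      fix b assume b: "b \<in> \<Inter>?Y \<inter> \<Inter>(E - {e})"
      have "b \<in> y" if y: "y \<in> Y" for y
      proof -
        obtain e' where "e' \<in> E" "e' \<subseteq> y" using r y by blast
        then show ?thesis using b y by (cases "e' = e") auto
      qed
      then show "b \<in> p" using Y by blast
    qed
    \<comment> \<open>Otherwise \<open>bd\<close> would say that \<open>E - {e}\<close> covers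
      \<open>p\<close>.\<close>
    have ne: "?Y \<noteq> {}"
    proof
      assume Y0: "?Y = {}"
      show False using bd irr[OF e] unfolding Y0 by simp
    qed
    have "\<Inter>?Y \<in> filters" using Y ne by (intro filters_Inter) auto
    moreover have "e \<subseteq> \<Inter>?Y" by blast
    ultimately have eq: "\<Inter>?Y = e" using mx[OF e] bd by blast
    have "\<Inter>?Y \<in> irreducible_filters" unfolding eq using Ei e by blast
    then have "\<Inter>?Y \<in> ?Y" using Y ne by (intro irreducible_Inter) auto
    then show "e \<in> Y" unfolding eq by simp
  qed
  then show thesis using that E Ei ref by blast
qed

text \<open>Transfers \<open>minimal_cover_exists\<close> along \<open>principal\<close>, after
  picking finite families of filters out of the unions of the given covers.\<close>

lemma strongly_spatial_closed_lattice: "strongly_spatial closed_lattice"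
  unfolding strongly_spatial_def
proof (intro conjI ballI allI impI)
  show "lattice closed_lattice" using complete_closed_lattice by simp
  show "join_dense closed_lattice (points closed_lattice)"
    unfolding join_dense_def points_closed_lattice
  proof (intro conjI ballI)
    show "principal ` irreducible_filters \<subseteq> carrier closed_lattice" using principal_closed by auto
    fix X assume "X \<in> carrier closed_lattice"
    then have X: "X \<in> closed_sets" by simp
    show "\<exists>A\<subseteq>principal ` irreducible_filters. is_lub closed_lattice X A"
      using is_lub_principal[OF X] image_mono[OF closed_sets_irreducible[OF X]]
      by (intro exI[of _ "principal ` X"] conjI)
  qed
  fix P A assume "P \<in> points closed_lattice" and A: "join_cover closed_lattice P A"
  then obtain p where p: "p \<in> irreducible_filters" and P: "P = principal p"
    using points_closed_lattice by blast
  obtain F where F: "F \<subseteq> \<Union>A" "finite F" "\<Inter>F \<subseteq> p" and Ac: "A \<subseteq> closed_sets"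
    using A unfolding P join_cover_closed_lattice[OF p] by (elim conjE exE)
  have "F \<subseteq> filters" using F Ac closed_sets_irreducible irreducible_filter by blast
  then obtain E where E: "irredundant_cover p E" "E \<subseteq> irreducible_filters" "\<forall>e\<in>E. \<exists>f\<in>F. f \<subseteq> e"
    and mn: "\<And>Y. finite Y \<Longrightarrow> Y \<subseteq> filters \<Longrightarrow> \<Inter>Y \<subseteq> p \<Longrightarrow> \<forall>y\<in>Y. \<exists>e\<in>E. e \<subseteq> y \<Longrightarrow> E \<subseteq> Y"
    using minimal_cover_exists[OF p F(2) _ F(3)] by blast
  have fin: "finite E" and cov: "\<Inter>E \<subseteq> p" and irr: "\<And>e. e \<in> E \<Longrightarrow> \<not> \<Inter>(E - {e}) \<subseteq> p"
    using E(1) unfolding irredundant_cover_def by auto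
  let ?I = "principal ` E"
  have "join_cover closed_lattice P ?I"
    unfolding P join_cover_closed_lattice[OF p]
  proof (intro conjI exI)
    show "E \<subseteq> \<Union>?I" using E(2) principal_refl by blast
  qed (use fin cov principal_closed in auto)
  moreover have "?I \<subseteq> X" if X: "join_cover closed_lattice P X" and r: "refines closed_lattice X ?I" for X
  proof -
    obtain Y where Y: "Y \<subseteq> \<Union>X" "finite Y" "\<Inter>Y \<subseteq> p" and Xc: "X \<subseteq> closed_sets"
      using X unfolding P join_cover_closed_lattice[OF p] by (elim conjE exE)
    have Xr: "\<exists>e\<in>E. Z \<subseteq> principal e" if "Z \<in> X" for Z
      using r that unfolding refines_def by auto
    have "Y \<subseteq> filters" using Y Xc closed_sets_irreducible irreducible_filter by blast
    moreover have "\<forall>y\<in>Y. \<exists>e\<in>E. e \<subseteq> y"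
    proof
      fix y assume "y \<in> Y"
      then obtain Z where "Z \<in> X" "y \<in> Z" using Y(1) by blast
      then obtain e where "e \<in> E" "y \<in> principal e" using Xr[of Z] by blast
      then show "\<exists>e\<in>E. e \<subseteq> y" unfolding principal_def by blast
    qed
    ultimately have EY: "E \<subseteq> Y" using mn Y by blast
    have "principal e \<in> X" if e: "e \<in> E" for e
    proof -
      obtain Z where Z: "Z \<in> X" "e \<in> Z" using EY Y e by blast
      obtain e' where e': "e' \<in> E" "Z \<subseteq> principal e'" using Xr Z by blast
      then have sub: "e' \<subseteq> e" using Z unfolding principal_def by blast
      \<comment> \<open>Distinct members of an irredundant cover are incomparable; this squeezes
        \<open>Z\<close> between \<open>principal e\<close> and itself.\<close>
      have "e' = e"
      proof (rule ccontr)
        assume "e' \<noteq> e"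
        then have "\<Inter>(E - {e}) \<subseteq> \<Inter>E" using sub e' by blast
        then show False using cov irr[OF e] by blast
      qed
      then have "Z = principal e" using e' Z Xc principal_subset by blast
      then show ?thesis using Z by simp
    qed
    then show ?thesis by blast
  qed
  moreover have "refines closed_lattice ?I A"
    unfolding refines_def
  proof
    fix Z assume "Z \<in> ?I"
    then obtain e where e: "e \<in> E" "Z = principal e" by blast
    then obtain f where "f \<in> F" "f \<subseteq> e" using E(3) by blast
    then obtain a where f: "f \<subseteq> e" "f \<in> a" "a \<in> A" using F(1) by blast
    then have "Z \<subseteq> a" using principal_subset[of a f] e Ac unfolding principal_def by blast
    then show "\<exists>a\<in>A. Z \<sqsubseteq>\<^bsub>closed_lattice\<^esub> a" using f by auto
  qed
  ultimately show "\<exists>I. minimal_join_cover closed_lattice P I \<and> I \<subseteq> points closed_lattice \<and>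
      refines closed_lattice I A"
    unfolding minimal_join_cover_def points_closed_lattice using E(2) by blast
qed

section \<open>The embedding and the variety\<close>

text \<open>For \<open>a\<close> in the carrier, \<open>a \<in> p\<close> means that
  \<open>p\<close> lies below the principal filter of \<open>a\<close> in the reverse order.\<close>

definition embed :: "'a \<Rightarrow> 'a set set" where
  "embed a = {p \<in> irreducible_filters. a \<in> p}"

lemma embed_closed: "embed a \<in> closed_sets"
  by (rule closed_setsI) (auto simp: embed_def)

text \<open>The refinement that makes joins survive the restriction to irreducible filters; it
  serves both \<open>embed_join\<close> and the evaluation of \<open>Join\<close> terms.\<close>

lemma join_irreducible_cover:
  assumes p: "p \<in> irreducible_filters" and FG: "F \<in> filters" "G \<in> filters" "F \<inter> G \<subseteq> p"
  obtains E where "finite E" "E \<subseteq> irreducible_filters" "\<Inter>E \<subseteq> p" "\<forall>e\<in>E. F \<subseteq> e \<or> G \<subseteq> e"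
proof -
  obtain E where E: "irredundant_cover p E" "E \<subseteq> irreducible_filters"
      "\<forall>e\<in>E. \<exists>f\<in>{F, G}. f \<subseteq> e"
    using minimal_cover_exists[OF p, of "{F, G}"] FG by simp metis
  show thesis
  proof (rule that)
    show "\<forall>e\<in>E. F \<subseteq> e \<or> G \<subseteq> e" using E(3) by simp
  qed (use E in \<open>simp_all add: irredundant_cover_def\<close>)
qed

lemma embed_join:
  assumes "a \<in> carrier L" "b \<in> carrier L"
  shows "embed (a \<squnion> b) = cover_closure (embed a \<union> embed b)"
proof
  have "embed a \<subseteq> embed (a \<squnion> b)" "embed b \<subseteq> embed (a \<squnion> b)"
    unfolding embed_def using assms irreducible_filter
    by (auto intro: filters_up join_left join_right)
  then show "cover_closure (embed a \<union> embed b) \<subseteq> embed (a \<squnion> b)"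
    by (simp add: cover_closure_least embed_closed)
  show "embed (a \<squnion> b) \<subseteq> cover_closure (embed a \<union> embed b)"
  proof
    fix p assume "p \<in> embed (a \<squnion> b)"
    then have p: "p \<in> irreducible_filters" "a \<squnion> b \<in> p" by (auto simp: embed_def)
    let ?F = "\<lambda>a. {b \<in> carrier L. a \<sqsubseteq> b}"
    have "?F a \<inter> ?F b \<subseteq> p"
      using p irreducible_filter assms by (auto intro: filters_up join_le)
    then obtain E where E: "finite E" "E \<subseteq> irreducible_filters" "\<Inter>E \<subseteq> p"
        "\<forall>e\<in>E. ?F a \<subseteq> e \<or> ?F b \<subseteq> e"
      by (rule join_irreducible_cover[OF p(1) principal_filter[OF assms(1)] principal_filter[OF assms(2)]])
    moreover have "a \<in> ?F a" "b \<in> ?F b" using assms by auto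
    ultimately have "E \<subseteq> embed a \<union> embed b" unfolding embed_def by blast
    then show "p \<in> cover_closure (embed a \<union> embed b)"
      using E(1,3) p(1) by (intro cover_closureI)
  qed
qed

lemma embed_meet:
  assumes "a \<in> carrier L" "b \<in> carrier L"
  shows "embed (a \<sqinter> b) = embed a \<inter> embed b"
  unfolding embed_def using assms irreducible_filter
  by (auto intro: filters_up filters_meet meet_left meet_right)

lemma embed_le:
  assumes "a \<in> carrier L" "b \<in> carrier L" "embed a \<subseteq> embed b"
  shows "a \<sqsubseteq> b"
proof (rule ccontr)
  assume "\<not> a \<sqsubseteq> b"
  then obtain p where "p \<in> irreducible_filters" "{b \<in> carrier L. a \<sqsubseteq> b} \<subseteq> p" "b \<notin> p"
    using irreducible_filter_separates[OF principal_filter[OF assms(1)] assms(2)] by blast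
  then show False using assms unfolding embed_def by auto
qed

lemma lattice_embedding_embed: "lattice_embedding L closed_lattice embed"
  unfolding lattice_embedding_def join_pres_def meet_pres_def
  using lattice_axioms complete_closed_lattice embed_closed embed_le
  by (auto simp: embed_join embed_meet join_closed_lattice meet_closed_lattice intro!: inj_onI)

section \<open>Term evaluation in the filter lattice under reverse inclusion, and in the closed
  sets\<close>

primrec filter_eval :: "(nat \<Rightarrow> 'a set) \<Rightarrow> lat_term \<Rightarrow> 'a set" where
  "filter_eval w (Var i) = w i"
| "filter_eval w (Join s t) = filter_eval w s \<inter> filter_eval w t"
| "filter_eval w (Meet s t) = filter_join (filter_eval w s) (filter_eval w t)"

lemma filter_eval_filters: "(\<And>i. w i \<in> filters) \<Longrightarrow> filter_eval w s \<in> filters"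
  by (induction s) (auto intro: filters_Int filter_join_filters)

lemma filter_eval_mono: "(\<And>i. w i \<subseteq> w' i) \<Longrightarrow> filter_eval w s \<subseteq> filter_eval w' s"
  by (induction s) (auto simp: filter_join_def)

lemma lat_eval_carrier: "(\<And>i. u i \<in> carrier L) \<Longrightarrow> lat_eval L u s \<in> carrier L"
  by (induction s) auto

lemma lat_eval_mono:
  assumes "\<And>i. u i \<in> carrier L" "\<And>i. u' i \<in> carrier L" "\<And>i. u i \<sqsubseteq> u' i"
  shows "lat_eval L u s \<sqsubseteq> lat_eval L u' s"
  by (induction s) (auto simp: assms lat_eval_carrier intro: join_mono meet_mono)

text \<open>The value of a term on filters is generated by its values on elements of these filters.
  Terms are monotone, so two choices \<open>u\<close> and \<open>u'\<close> for the subterms may be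
  replaced by their pointwise meet. Identities of \<open>L\<close> thereby pass to filters.\<close>

lemma filter_eval_iff:
  assumes w: "\<And>i. w i \<in> filters"
  shows "a \<in> filter_eval w s \<longleftrightarrow>
    a \<in> carrier L \<and> (\<exists>u. (\<forall>i. u i \<in> w i) \<and> lat_eval L u s \<sqsubseteq> a)"
proof
  have wL: "x \<in> carrier L" if "x \<in> w i" for x i using that w filters_mem by blast
  have mem: "lat_eval L u s \<in> filter_eval w s" if "\<forall>i. u i \<in> w i" for u
  proof (induction s)
    case (Join s t)
    have c: "lat_eval L u s \<in> carrier L" "lat_eval L u t \<in> carrier L"
      using lat_eval_carrier wL that by blast+
    then show ?case
      using Join filters_up[OF filter_eval_filters] w join_left[OF c] join_right[OF c] by simp
  next
    case (Meet s t)
    have "lat_eval L u (Meet s t) \<in> carrier L" using lat_eval_carrier wL that by blast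
    then show ?case using Meet by (auto simp: filter_join_def)
  qed (use that in auto)
  show "a \<in> filter_eval w s" if "a \<in> carrier L \<and> (\<exists>u. (\<forall>i. u i \<in> w i) \<and> lat_eval L u s \<sqsubseteq> a)"
    using that mem filters_up[OF filter_eval_filters] w by blast
  show "a \<in> carrier L \<and> (\<exists>u. (\<forall>i. u i \<in> w i) \<and> lat_eval L u s \<sqsubseteq> a)" if "a \<in> filter_eval w s"
    using that
  proof (induction s arbitrary: a)
    case (Var k)
    \<comment> \<open>Arbitrary elements serve for the variables other than \<open>k\<close>; they
      exist because filters are nonempty.\<close>
    let ?u = "\<lambda>i. SOME x. x \<in> w i"
    have u: "(SOME x. x \<in> w i) \<in> w i" for i using filters_ne[OF w] by (simp add: some_in_eq)
    have "a \<in> carrier L" using Var wL by simp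
    moreover have "\<forall>i. (?u(k := a)) i \<in> w i" using u Var by simp
    moreover have "lat_eval L (?u(k := a)) (Var k) \<sqsubseteq> a" using \<open>a \<in> carrier L\<close> by simp
    ultimately show ?case by blast
  next
    case (Join s t)
    then obtain u u' where u: "\<forall>i. u i \<in> w i" "lat_eval L u s \<sqsubseteq> a"
      and u': "\<forall>i. u' i \<in> w i" "lat_eval L u' t \<sqsubseteq> a" and a: "a \<in> carrier L" by force
    let ?u = "\<lambda>i. u i \<sqinter> u' i"
    have m: "\<forall>i. ?u i \<in> w i" using u(1) u'(1) filters_meet[OF w] by simp
    have c: "u i \<in> carrier L" "u' i \<in> carrier L" for i
      using wL[OF u(1)[rule_format]] wL[OF u'(1)[rule_format]] by auto
    have "lat_eval L ?u s \<sqsubseteq> lat_eval L u s" "lat_eval L ?u t \<sqsubseteq> lat_eval L u' t"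
      using c by (auto intro!: lat_eval_mono meet_left meet_right)
    then have "lat_eval L ?u s \<sqsubseteq> a" "lat_eval L ?u t \<sqsubseteq> a"
      using le_trans[OF _ u(2)] le_trans[OF _ u'(2)] a c lat_eval_carrier by auto
    then have "lat_eval L ?u (Join s t) \<sqsubseteq> a"
      using a c lat_eval_carrier[of ?u] by (simp add: join_le)
    then show ?case using m a by (intro conjI exI[of _ ?u])
  next
    case (Meet s t)
    then obtain b d where bd: "b \<in> filter_eval w s" "d \<in> filter_eval w t" "b \<sqinter> d \<sqsubseteq> a"
      and a: "a \<in> carrier L" by (auto simp: filter_join_def)
    then obtain u u' where u: "\<forall>i. u i \<in> w i" "lat_eval L u s \<sqsubseteq> b"
      and u': "\<forall>i. u' i \<in> w i" "lat_eval L u' t \<sqsubseteq> d" and b: "b \<in> carrier L" "d \<in> carrier L"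
      using Meet.IH by meson
    let ?u = "\<lambda>i. u i \<sqinter> u' i"
    have m: "\<forall>i. ?u i \<in> w i" using u(1) u'(1) filters_meet[OF w] by simp
    have c: "u i \<in> carrier L" "u' i \<in> carrier L" for i
      using wL[OF u(1)[rule_format]] wL[OF u'(1)[rule_format]] by auto
    have "lat_eval L ?u s \<sqsubseteq> lat_eval L u s" "lat_eval L ?u t \<sqsubseteq> lat_eval L u' t"
      using c by (auto intro!: lat_eval_mono meet_left meet_right)
    then have "lat_eval L ?u s \<sqsubseteq> b" "lat_eval L ?u t \<sqsubseteq> d"
      using le_trans[OF _ u(2)] le_trans[OF _ u'(2)] b c lat_eval_carrier by auto
    then have "lat_eval L ?u s \<sqinter> lat_eval L ?u t \<sqsubseteq> b \<sqinter> d"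
      using b c lat_eval_carrier[of ?u] by (intro meet_mono) auto
    then have "lat_eval L ?u (Meet s t) \<sqsubseteq> a"
      using le_trans[OF _ bd(3)] a b c lat_eval_carrier[of ?u] by simp
    then show ?case using m a by (intro conjI exI[of _ ?u])
  qed
qed

lemma lat_eval_closed:
  assumes "\<And>i. v i \<in> closed_sets"
  shows "lat_eval closed_lattice v s \<in> closed_sets"
  using assms
  by (induction s) (auto simp: join_closed_lattice meet_closed_lattice cover_closure_closed
      intro: closed_sets_Int)

text \<open>Here \<open>w i\<close> ranges over the filters in the ideal generated by \<open>v i\<close>. The intersection with
  \<open>carrier L\<close> only matters for \<open>E = {}\<close>, where it yields the least element of the filter lattice.\<close>

lemma lat_eval_closed_lattice_iff:
  assumes v: "\<And>i. v i \<in> closed_sets" and p: "p \<in> irreducible_filters"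
  shows "p \<in> lat_eval closed_lattice v s \<longleftrightarrow>
    (\<exists>w. (\<forall>i. w i \<in> filters \<and> (\<exists>E\<subseteq>v i. finite E \<and> carrier L \<inter> \<Inter>E \<subseteq> w i)) \<and> filter_eval w s \<subseteq> p)"
    (is "_ \<longleftrightarrow> (\<exists>w. (\<forall>i. ?A i (w i)) \<and> _)")
proof
  \<comment> \<open>The least filter belongs to every ideal, with \<open>E = {}\<close>; it is the
    default value for variables that do not matter.\<close>
  have top: "?A i (carrier L)" for i using carrier_filter irreducible_filter[OF p] by blast
  \<comment> \<open>Ideals are closed under joins, so finitely many choices of \<open>w\<close> can
    be merged by pointwise intersection.\<close>
  have Int: "?A i (F \<inter> G)" if FG: "?A i F" "?A i G" for i F G
  proof -
    obtain E E' where E: "E \<subseteq> v i" "finite E" "carrier L \<inter> \<Inter>E \<subseteq> F"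
      "E' \<subseteq> v i" "finite E'" "carrier L \<inter> \<Inter>E' \<subseteq> G" using FG by auto
    then have "E \<union> E' \<subseteq> v i" "finite (E \<union> E')" "carrier L \<inter> \<Inter>(E \<union> E') \<subseteq> F \<inter> G" by auto
    then show ?thesis using FG filters_Int by meson
  qed
  show "p \<in> lat_eval closed_lattice v s" if ex: "\<exists>w. (\<forall>i. ?A i (w i)) \<and> filter_eval w s \<subseteq> p"
  proof -
    obtain w where w: "\<forall>i. ?A i (w i)" and "filter_eval w s \<subseteq> p" using ex by blast
    then have wf: "filter_eval w r \<in> filters" for r by (intro filter_eval_filters) blast
    show ?thesis using p \<open>filter_eval w s \<subseteq> p\<close>
    proof (induction s arbitrary: p)
      case (Var k)
      obtain E where E: "E \<subseteq> v k" "finite E" "carrier L \<inter> \<Inter>E \<subseteq> w k"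
        using w[rule_format, of k] by (elim conjE exE)
      have "E \<noteq> {}"
      proof
        assume "E = {}"
        then have "carrier L \<subseteq> p" using E Var by auto
        then show False using Var(1) filters_subset[OF irreducible_filter[OF Var(1)]]
          unfolding irreducible_filters_def by blast
      qed
      moreover have "E \<subseteq> filters" using E v[of k] closed_sets_irreducible irreducible_filter by blast
      ultimately have "\<Inter>E \<subseteq> carrier L" using filters_subset by blast
      then have "\<Inter>E \<subseteq> p" using E Var by auto
      then show ?case using closed_setsD[OF v Var(1) E(1,2)] by simp
    next
      case (Join s t)
      obtain E where E: "finite E" "E \<subseteq> irreducible_filters" "\<Inter>E \<subseteq> p"
        "\<forall>e\<in>E. filter_eval w s \<subseteq> e \<or> filter_eval w t \<subseteq> e"
        by (rule join_irreducible_cover[OF Join.prems(1) wf wf Join.prems(2)[simplified]])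
      \<comment> \<open>The choice \<open>w\<close> stays fixed while \<open>p\<close> varies, so
        the induction hypotheses apply to each member of \<open>E\<close>.\<close>
      then have "E \<subseteq> lat_eval closed_lattice v s \<union> lat_eval closed_lattice v t"
        using Join.IH by blast
      then show ?case
        using E Join.prems(1) v by (simp add: join_closed_lattice lat_eval_closed cover_closureI)
    next
      case (Meet s t)
      then have "filter_eval w s \<subseteq> p" "filter_eval w t \<subseteq> p"
        using filter_join_upper[OF wf[of s] wf[of t]] by auto
      then show ?case using Meet v by (simp add: meet_closed_lattice lat_eval_closed)
    qed
  qed
  show "\<exists>w. (\<forall>i. ?A i (w i)) \<and> filter_eval w s \<subseteq> p" if "p \<in> lat_eval closed_lattice v s"
    using that p
  proof (induction s arbitrary: p)
    case (Var k)
    have "?A k p" using Var irreducible_filter by (auto intro!: exI[of _ "{p}"])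
    then have "\<forall>i. ?A i (if i = k then p else carrier L)" using top by simp
    moreover have "filter_eval (\<lambda>i. if i = k then p else carrier L) (Var k) \<subseteq> p" by simp
    ultimately show ?case by (intro exI[of _ "\<lambda>i. if i = k then p else carrier L"] conjI)
  next
    case (Join s t)
    then have "p \<in> cover_closure (lat_eval closed_lattice v s \<union> lat_eval closed_lattice v t)"
      using v by (simp add: join_closed_lattice lat_eval_closed)
    then obtain E where E: "E \<subseteq> lat_eval closed_lattice v s \<union> lat_eval closed_lattice v t"
      "finite E" "\<Inter>E \<subseteq> p" unfolding cover_closure_def by blast
    \<comment> \<open>Each member of \<open>E\<close> has its own choice, obtained from
      \<open>s\<close> or from \<open>t\<close>; an inner induction merges them into one.\<close>
    have "\<exists>w. (\<forall>i. ?A i (w i)) \<and> filter_eval w (Join s t) \<subseteq> \<Inter>E"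
      using E(2,1)
    proof (induction E rule: finite_induct)
      case empty
      have "\<forall>i. ?A i (carrier L)" using top by blast
      then show ?case by (auto intro!: exI[of _ "\<lambda>_. carrier L"])
    next
      case (insert e E)
      then obtain w where w: "\<forall>i. ?A i (w i)" "filter_eval w (Join s t) \<subseteq> \<Inter>E" by auto
      have "e \<in> irreducible_filters"
        using insert.prems closed_sets_irreducible lat_eval_closed[of v] v by blast
      then obtain w' where w': "\<forall>i. ?A i (w' i)" "filter_eval w' (Join s t) \<subseteq> e"
      proof (cases "e \<in> lat_eval closed_lattice v s")
        case True
        then obtain w' where "\<forall>i. ?A i (w' i)" "filter_eval w' s \<subseteq> e"
          using Join.IH(1)[OF True \<open>e \<in> irreducible_filters\<close>] by (elim exE conjE)
        then show thesis by (intro that[of w']) auto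
      next
        case False
        then have "e \<in> lat_eval closed_lattice v t" using insert.prems by blast
        from Join.IH(2)[OF this \<open>e \<in> irreducible_filters\<close>] obtain w' where "\<forall>i. ?A i (w' i)" "filter_eval w' t \<subseteq> e"
          by (elim exE conjE)
        then show thesis by (intro that[of w']) auto
      qed
      let ?w = "\<lambda>i. w i \<inter> w' i"
      have "\<forall>i. ?A i (?w i)" by (intro allI Int w(1)[rule_format] w'(1)[rule_format])
      moreover have "filter_eval ?w (Join s t) \<subseteq> \<Inter>(insert e E)"
        using filter_eval_mono[of ?w w "Join s t"] filter_eval_mono[of ?w w' "Join s t"] w(2) w'(2) by blast
      ultimately show ?case by (intro exI[of _ ?w] conjI)
    qed
    then show ?case using E(3) by blast
  next
    case (Meet s t)
    then have "p \<in> lat_eval closed_lattice v s" "p \<in> lat_eval closed_lattice v t"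
      using v by (auto simp: meet_closed_lattice lat_eval_closed)
    then obtain w w' where w: "\<forall>i. ?A i (w i)" "filter_eval w s \<subseteq> p"
      and w': "\<forall>i. ?A i (w' i)" "filter_eval w' t \<subseteq> p" using Meet by meson
    let ?w = "\<lambda>i. w i \<inter> w' i"
    have "\<forall>i. ?A i (?w i)" by (intro allI Int w(1)[rule_format] w'(1)[rule_format])
    moreover have "filter_eval ?w (Meet s t) \<subseteq> p"
      using filter_eval_mono[of ?w w s] filter_eval_mono[of ?w w' t] w w'
        filter_join_least[OF irreducible_filter[OF Meet.prems(2)]] by simp
    ultimately show ?case by (intro exI[of _ ?w] conjI)
  qed
qed

text \<open>An identity passes from \<open>L\<close> to filters by \<open>filter_eval_iff\<close>,
  and from filters to closed sets by \<open>lat_eval_closed_lattice_iff\<close>, whose right-hand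
  side depends on the term through \<open>filter_eval\<close> alone.\<close>

lemma in_variety_closed_lattice: "in_variety_of closed_lattice L"
  unfolding in_variety_of_def
proof (intro conjI allI impI)
  show "lattice closed_lattice" using complete_closed_lattice by simp
  fix s t assume id: "satisfies_identity L s t"
  have fe: "filter_eval w s = filter_eval w t" if w: "\<And>i. w i \<in> filters" for w :: "nat \<Rightarrow> 'a set"
  proof -
    have "lat_eval L u s = lat_eval L u t" if "\<forall>i. u i \<in> w i" for u
    proof -
      have "u i \<in> carrier L" for i using filters_mem[OF w] that by blast
      then show ?thesis using id unfolding satisfies_identity_def by (simp add: Pi_def)
    qed
    then have "(\<exists>u. (\<forall>i. u i \<in> w i) \<and> lat_eval L u s \<sqsubseteq> a) \<longleftrightarrow>
        (\<exists>u. (\<forall>i. u i \<in> w i) \<and> lat_eval L u t \<sqsubseteq> a)" for a by (metis (no_types))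
    then show ?thesis by (simp add: set_eq_iff filter_eval_iff[of w, OF w])
  qed
  show "satisfies_identity closed_lattice s t"
    unfolding satisfies_identity_def
  proof
    fix v :: "nat \<Rightarrow> 'a set set" assume "v \<in> UNIV \<rightarrow> carrier closed_lattice"
    then have v: "\<And>i. v i \<in> closed_sets" by auto
    have "p \<in> lat_eval closed_lattice v s \<longleftrightarrow> p \<in> lat_eval closed_lattice v t"
      if "p \<in> irreducible_filters" for p
      unfolding lat_eval_closed_lattice_iff[of v, OF v that] using fe by (metis (no_types, lifting))
    then show "lat_eval closed_lattice v s = lat_eval closed_lattice v t"
      using lat_eval_closed[of v, OF v] closed_sets_irreducible by blast
  qed
qed

end

theorem theorem5p3:
  fixes n :: nat and L :: "'a gorder"
  assumes "n > 0" and "lattice L" and "n_distributive n L"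
  shows "\<exists>(M :: 'a set set gorder) f.
    lattice_embedding L M f \<and> in_variety_of M L \<and>
    algebraic_lattice M \<and> strongly_spatial M \<and>
    (has_least L \<longrightarrow> has_least M) \<and>
    (has_greatest L \<longrightarrow> has_greatest M) \<and>
    (has_least L \<and> has_greatest L \<longrightarrow> has_least M \<and> has_greatest M)"
proof -
  interpret lattice L by fact
  interpret n_distributive_lattice L n by unfold_locales (use assms in auto)
  interpret M: complete_lattice closed_lattice by (rule complete_closed_lattice)
  have "has_least closed_lattice" "has_greatest closed_lattice"
    unfolding has_least_def has_greatest_def using M.bottom_exists M.top_exists by auto
  then show ?thesis
    using lattice_embedding_embed in_variety_closed_lattice algebraic_closed_lattice
      strongly_spatial_closed_lattice by blast
qed

end
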